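(* Let $M$ be a $\sigma$-finite von Neumann algebra, and let $\varphi,\psi$ be normal faithful states on $M$ such that $\varphi|_{\mathcal{Z}(M)}=\psi|_{\mathcal{Z}(M)}$. Then $\dot\varphi_\omega=\dot\psi_\omega$, where $\dot\varphi_\omega:=\varphi^\omega|_{M'\cap M^\omega}$ and $\dot\psi_\omega:=\psi^\omega|_{M'\cap M^\omega}$. In particular, if $M$ is a $\sigma$-finite factor, then $\dot\varphi_\omega$ does not depend on the normal faithful state $\varphi$.
   Context: $\omega$ is a fixed free ultrafilter on $\mathbb{N}$; $\mathcal{Z}(M)$ is the center of $M$. Ocneanu ultrapower: for a normal faithful state $\varphi$ on $M$, let $\|x\|_\varphi^\sharp=\varphi(x^*x+xx^* )^{1/2}$, $\mathcal{I}_\omega=\{(x_n)_n\in\ell^\infty(\mathbb{N},M):\lim_{n\to\omega}\|x_n\|_\varphi^\sharp=0\}$, $\mathcal{M}^\omega=\{(x_n)_n\in\ell^\infty(\mathbb{N},M):(x_n)_n\mathcal{I}_\omega\subset\mathcal{I}_\omega,\ \mathcal{I}_\omega(x_n)_n\subset\mathcal{I}_\omega\}$, and $M^\omega=\mathcal{M}^\omega/\mathcal{I}_\omega$, which does not depend on $\varphi$. The class of $(x_n)_n$ is $(x_n)^\omega$; $\varphi^\omega((x_n)^\omega)=\lim_{n\to\omega}\varphi(x_n)$ is a normal faithful state on $M^\omega$. $M$ is viewed as a subalgebra of $M^\omega$ via constant sequences, and $M'\cap M^\omega$ is the relative commutant. *)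

theory Defs
  imports "HOL-Analysis.Analysis" "HOL-Algebra.QuotRing"
begin

text \<open>
  The real part of the complex inner product is the library's real inner product, so the norm
  and the topology are those of the underlying real Hilbert space, and the norm on
  \<open>'h \<Rightarrow>\<^sub>L 'h\<close> is the usual operator norm. The inner product is linear in its first argument.
\<close>

class complex_hilbert_space = real_inner + complete_space +
  fixes scaleC :: "complex \<Rightarrow> 'a \<Rightarrow> 'a"  (infixr \<open>*\<^sub>C\<close> 75)
    and cinner :: "'a \<Rightarrow> 'a \<Rightarrow> complex"
  assumes scaleC_of_real: "complex_of_real r *\<^sub>C x = r *\<^sub>R x"
    and scaleC_add_right: "c *\<^sub>C (x + y) = c *\<^sub>C x + c *\<^sub>C y"
    and scaleC_add_left: "(c + d) *\<^sub>C x = c *\<^sub>C x + d *\<^sub>C x"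
    and scaleC_scaleC: "c *\<^sub>C d *\<^sub>C x = (c * d) *\<^sub>C x"
    and cinner_commute: "cinner x y = cnj (cinner y x)"
    and cinner_add_left: "cinner (x + y) z = cinner x z + cinner y z"
    and cinner_scaleC_left: "cinner (c *\<^sub>C x) y = c * cinner x y"
    and Re_cinner: "Re (cinner x y) = x \<bullet> y"
begin

lemma cinner_scaleC_right: "cinner x (c *\<^sub>C y) = cnj c * cinner x y"
  by (metis cinner_commute cinner_scaleC_left complex_cnj_mult)

lemma cinner_self: "cinner x x = complex_of_real (x \<bullet> x)"
proof -
  have "Im (cinner x x) = 0"
    using arg_cong[OF cinner_commute[of x x], of Im] by simp
  then show ?thesis by (simp add: complex_eq_iff Re_cinner)
qed

lemma norm_scaleC: "norm (c *\<^sub>C x) = cmod c * norm x"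
proof -
  have "complex_of_real ((norm (c *\<^sub>C x))\<^sup>2) = cinner (c *\<^sub>C x) (c *\<^sub>C x)"
    by (simp add: cinner_self power2_norm_eq_inner)
  also have "\<dots> = (c * cnj c) * cinner x x"
    by (simp add: cinner_scaleC_left cinner_scaleC_right algebra_simps)
  also have "\<dots> = complex_of_real ((cmod c * norm x)\<^sup>2)"
    by (simp add: cinner_self power2_norm_eq_inner power_mult_distrib
        flip: complex_norm_square)
  finally have "(norm (c *\<^sub>C x))\<^sup>2 = (cmod c * norm x)\<^sup>2"
    using of_real_eq_iff by blast
  then show ?thesis
    by (simp add: power2_eq_iff_nonneg)
qed

end

lemma bounded_linear_scaleC: "bounded_linear (\<lambda>x::'h::complex_hilbert_space. c *\<^sub>C x)"
proof
  show "c *\<^sub>C (x + y) = c *\<^sub>C x + c *\<^sub>C y" for x y :: 'h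
    by (rule scaleC_add_right)
  show "c *\<^sub>C r *\<^sub>R x = r *\<^sub>R c *\<^sub>C x" for r and x :: 'h
    by (simp add: scaleC_scaleC mult.commute flip: scaleC_of_real)
  show "\<exists>K. \<forall>x::'h. norm (c *\<^sub>C x) \<le> norm x * K"
    by (rule exI[of _ "cmod c"]) (simp add: norm_scaleC mult.commute)
qed

lift_definition scaleC_op ::
    "complex \<Rightarrow> ('h::complex_hilbert_space \<Rightarrow>\<^sub>L 'h) \<Rightarrow> ('h \<Rightarrow>\<^sub>L 'h)"
  is "\<lambda>c T x. c *\<^sub>C T x"
  by (rule bounded_linear_compose[OF bounded_linear_scaleC])

text \<open>The elements of \<open>'h \<Rightarrow>\<^sub>L 'h\<close> are only real-linear.\<close>

definition bounded_ops :: "('h::complex_hilbert_space \<Rightarrow>\<^sub>L 'h) set" where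
  "bounded_ops = {T. \<forall>c x. blinfun_apply T (c *\<^sub>C x) = c *\<^sub>C blinfun_apply T x}"

definition adj :: "('h::complex_hilbert_space \<Rightarrow>\<^sub>L 'h) \<Rightarrow> ('h \<Rightarrow>\<^sub>L 'h)" where
  "adj T = (THE S. \<forall>x y. cinner (blinfun_apply T x) y = cinner x (blinfun_apply S y))"

definition commutant :: "('h::complex_hilbert_space \<Rightarrow>\<^sub>L 'h) set \<Rightarrow> ('h \<Rightarrow>\<^sub>L 'h) set" where
  "commutant S = {T \<in> bounded_ops. \<forall>A\<in>S. T o\<^sub>L A = A o\<^sub>L T}"

text \<open>A commutant is always a unital subalgebra, so these conditions say that \<open>M\<close> is a
  \<open>*\<close>-subalgebra of the bounded operators that equals its bicommutant.\<close>

definition von_neumann_algebra :: "('h::complex_hilbert_space \<Rightarrow>\<^sub>L 'h) set \<Rightarrow> bool" where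
  "von_neumann_algebra M \<longleftrightarrow>
     M \<subseteq> bounded_ops \<and> (\<forall>x\<in>M. adj x \<in> M) \<and> commutant (commutant M) = M"

definition center :: "('h::complex_hilbert_space \<Rightarrow>\<^sub>L 'h) set \<Rightarrow> ('h \<Rightarrow>\<^sub>L 'h) set" where
  "center M = {z \<in> M. \<forall>x\<in>M. z o\<^sub>L x = x o\<^sub>L z}"

definition factor :: "('h::complex_hilbert_space \<Rightarrow>\<^sub>L 'h) set \<Rightarrow> bool" where
  "factor M \<longleftrightarrow> von_neumann_algebra M \<and> center M = range (\<lambda>c. scaleC_op c id_blinfun)"

definition projection :: "('h::complex_hilbert_space \<Rightarrow>\<^sub>L 'h) \<Rightarrow> bool" where
  "projection p \<longleftrightarrow> p \<in> bounded_ops \<and> p o\<^sub>L p = p \<and> adj p = p"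

definition sigma_finite_algebra :: "('h::complex_hilbert_space \<Rightarrow>\<^sub>L 'h) set \<Rightarrow> bool" where
  "sigma_finite_algebra M \<longleftrightarrow>
     (\<forall>P\<subseteq>M. (\<forall>p\<in>P. projection p \<and> p \<noteq> 0) \<and> (\<forall>p\<in>P. \<forall>q\<in>P. p \<noteq> q \<longrightarrow> p o\<^sub>L q = 0)
        \<longrightarrow> countable P)"

definition square_summable :: "(nat \<Rightarrow> 'h::real_normed_vector) \<Rightarrow> bool" where
  "square_summable \<xi> \<longleftrightarrow> summable (\<lambda>n. (norm (\<xi> n))\<^sup>2)"

text \<open>The sigma-weak (ultraweak) topology on the bounded operators, that is, the coarsest
  topology making all functionals \<open>T \<mapsto> (\<Sum>n. \<langle>T \<xi>\<^sub>n, \<eta>\<^sub>n\<rangle>)\<close> continuous.\<close>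

definition sigma_weak_topology :: "('h::complex_hilbert_space \<Rightarrow>\<^sub>L 'h) topology" where
  "sigma_weak_topology = topology_generated_by
     {{T \<in> bounded_ops. (\<Sum>n. cinner (blinfun_apply T (\<xi> n)) (\<eta> n)) \<in> U} | \<xi> \<eta> U.
        square_summable \<xi> \<and> square_summable \<eta> \<and> open U}"

text \<open>Functionals on \<open>M\<close> are total functions of which only the values on \<open>M\<close> matter.\<close>

definition state_on ::
    "('h::complex_hilbert_space \<Rightarrow>\<^sub>L 'h) set \<Rightarrow> (('h \<Rightarrow>\<^sub>L 'h) \<Rightarrow> complex) \<Rightarrow> bool" where
  "state_on M \<phi> \<longleftrightarrow>
     (\<forall>x\<in>M. \<forall>y\<in>M. \<phi> (x + y) = \<phi> x + \<phi> y) \<and>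
     (\<forall>c. \<forall>x\<in>M. \<phi> (scaleC_op c x) = c * \<phi> x) \<and>
     (\<forall>x\<in>M. \<phi> (adj x o\<^sub>L x) \<in> \<real>\<^sub>\<ge>\<^sub>0) \<and>
     \<phi> id_blinfun = 1"

definition normal_on ::
    "('h::complex_hilbert_space \<Rightarrow>\<^sub>L 'h) set \<Rightarrow> (('h \<Rightarrow>\<^sub>L 'h) \<Rightarrow> complex) \<Rightarrow> bool" where
  "normal_on M \<phi> \<longleftrightarrow> continuous_map (subtopology sigma_weak_topology M) euclidean \<phi>"

definition faithful_on ::
    "('h::complex_hilbert_space \<Rightarrow>\<^sub>L 'h) set \<Rightarrow> (('h \<Rightarrow>\<^sub>L 'h) \<Rightarrow> complex) \<Rightarrow> bool" where
  "faithful_on M \<phi> \<longleftrightarrow> (\<forall>x\<in>M. \<phi> (adj x o\<^sub>L x) = 0 \<longrightarrow> x = 0)"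

definition normal_faithful_state ::
    "('h::complex_hilbert_space \<Rightarrow>\<^sub>L 'h) set \<Rightarrow> (('h \<Rightarrow>\<^sub>L 'h) \<Rightarrow> complex) \<Rightarrow> bool" where
  "normal_faithful_state M \<phi> \<longleftrightarrow> state_on M \<phi> \<and> normal_on M \<phi> \<and> faithful_on M \<phi>"

definition free_ultrafilter :: "nat filter \<Rightarrow> bool" where
  "free_ultrafilter \<omega> \<longleftrightarrow> \<omega> \<noteq> bot \<and>
     (\<forall>P. eventually P \<omega> \<or> eventually (\<lambda>n. \<not> P n) \<omega>) \<and>
     (\<forall>m. eventually (\<lambda>n. n \<noteq> m) \<omega>)"

definition sharp_norm ::
    "(('h::complex_hilbert_space \<Rightarrow>\<^sub>L 'h) \<Rightarrow> complex) \<Rightarrow> ('h \<Rightarrow>\<^sub>L 'h) \<Rightarrow> real" where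
  "sharp_norm \<phi> x = sqrt (Re (\<phi> ((adj x o\<^sub>L x) + (x o\<^sub>L adj x))))"

definition bounded_seqs ::
    "('h::complex_hilbert_space \<Rightarrow>\<^sub>L 'h) set \<Rightarrow> (nat \<Rightarrow> ('h \<Rightarrow>\<^sub>L 'h)) set" where
  "bounded_seqs M = {x. (\<forall>n. x n \<in> M) \<and> bounded (range x)}"

definition null_seqs ::
    "nat filter \<Rightarrow> ('h::complex_hilbert_space \<Rightarrow>\<^sub>L 'h) set \<Rightarrow> (('h \<Rightarrow>\<^sub>L 'h) \<Rightarrow> complex)
      \<Rightarrow> (nat \<Rightarrow> ('h \<Rightarrow>\<^sub>L 'h)) set" where
  "null_seqs \<omega> M \<phi> = {x \<in> bounded_seqs M. ((\<lambda>n. sharp_norm \<phi> (x n)) \<longlongrightarrow> 0) \<omega>}"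

definition multiplier_seqs ::
    "nat filter \<Rightarrow> ('h::complex_hilbert_space \<Rightarrow>\<^sub>L 'h) set \<Rightarrow> (('h \<Rightarrow>\<^sub>L 'h) \<Rightarrow> complex)
      \<Rightarrow> (nat \<Rightarrow> ('h \<Rightarrow>\<^sub>L 'h)) set" where
  "multiplier_seqs \<omega> M \<phi> = {x \<in> bounded_seqs M. \<forall>y\<in>null_seqs \<omega> M \<phi>.
     (\<lambda>n. x n o\<^sub>L y n) \<in> null_seqs \<omega> M \<phi> \<and> (\<lambda>n. y n o\<^sub>L x n) \<in> null_seqs \<omega> M \<phi>}"

definition multiplier_ring ::
    "nat filter \<Rightarrow> ('h::complex_hilbert_space \<Rightarrow>\<^sub>L 'h) set \<Rightarrow> (('h \<Rightarrow>\<^sub>L 'h) \<Rightarrow> complex)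
      \<Rightarrow> (nat \<Rightarrow> ('h \<Rightarrow>\<^sub>L 'h)) ring" where
  "multiplier_ring \<omega> M \<phi> =
     \<lparr>carrier = multiplier_seqs \<omega> M \<phi>,
      mult = (\<lambda>x y n. x n o\<^sub>L y n), one = (\<lambda>_. id_blinfun),
      zero = (\<lambda>_. 0), add = (\<lambda>x y n. x n + y n)\<rparr>"

text \<open>Only the ring structure of the ultrapower is recorded; it is all that is needed to form
  the relative commutant. Its elements are the cosets modulo \<^const>\<open>null_seqs\<close>.\<close>

definition ocneanu_ultrapower ::
    "nat filter \<Rightarrow> ('h::complex_hilbert_space \<Rightarrow>\<^sub>L 'h) set \<Rightarrow> (('h \<Rightarrow>\<^sub>L 'h) \<Rightarrow> complex)
      \<Rightarrow> (nat \<Rightarrow> ('h \<Rightarrow>\<^sub>L 'h)) set ring" where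
  "ocneanu_ultrapower \<omega> M \<phi> = multiplier_ring \<omega> M \<phi> Quot null_seqs \<omega> M \<phi>"

definition const_class ::
    "nat filter \<Rightarrow> ('h::complex_hilbert_space \<Rightarrow>\<^sub>L 'h) set \<Rightarrow> (('h \<Rightarrow>\<^sub>L 'h) \<Rightarrow> complex)
      \<Rightarrow> ('h \<Rightarrow>\<^sub>L 'h) \<Rightarrow> (nat \<Rightarrow> ('h \<Rightarrow>\<^sub>L 'h)) set" where
  "const_class \<omega> M \<phi> a = null_seqs \<omega> M \<phi> +>\<^bsub>multiplier_ring \<omega> M \<phi>\<^esub> (\<lambda>_. a)"

definition relative_commutant ::
    "nat filter \<Rightarrow> ('h::complex_hilbert_space \<Rightarrow>\<^sub>L 'h) set \<Rightarrow> (('h \<Rightarrow>\<^sub>L 'h) \<Rightarrow> complex)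
      \<Rightarrow> (nat \<Rightarrow> ('h \<Rightarrow>\<^sub>L 'h)) set set" where
  "relative_commutant \<omega> M \<phi> = {X \<in> carrier (ocneanu_ultrapower \<omega> M \<phi>). \<forall>a\<in>M.
     const_class \<omega> M \<phi> a \<otimes>\<^bsub>ocneanu_ultrapower \<omega> M \<phi>\<^esub> X
       = X \<otimes>\<^bsub>ocneanu_ultrapower \<omega> M \<phi>\<^esub> const_class \<omega> M \<phi> a}"

text \<open>The value at a class is the common limit along \<open>\<omega>\<close> over all its representatives.\<close>

definition ultrapower_state ::
    "nat filter \<Rightarrow> (('h::complex_hilbert_space \<Rightarrow>\<^sub>L 'h) \<Rightarrow> complex)
      \<Rightarrow> (nat \<Rightarrow> ('h \<Rightarrow>\<^sub>L 'h)) set \<Rightarrow> complex" where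
  "ultrapower_state \<omega> \<phi> X = (THE c. \<forall>x\<in>X. ((\<lambda>n. \<phi> (x n)) \<longlongrightarrow> c) \<omega>)"

text \<open>
  The restriction of \<open>\<phi>\<^sup>\<omega>\<close> to \<open>M' \<inter> M\<^sup>\<omega>\<close>, with the ultrapower formed from \<open>\<phi>\<close> itself. An equality
  \<open>dot_state \<omega> M \<phi> = dot_state \<omega> M \<psi>\<close> therefore compares functions on the relative commutants in
  the ultrapowers formed from \<open>\<phi>\<close> and from \<open>\<psi>\<close>, which coincide because the ultrapower does not
  depend on the state; off its domain each function is \<^const>\<open>undefined\<close>.
\<close>

definition dot_state ::
    "nat filter \<Rightarrow> ('h::complex_hilbert_space \<Rightarrow>\<^sub>L 'h) set \<Rightarrow> (('h \<Rightarrow>\<^sub>L 'h) \<Rightarrow> complex)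
      \<Rightarrow> (nat \<Rightarrow> ('h \<Rightarrow>\<^sub>L 'h)) set \<Rightarrow> complex" where
  "dot_state \<omega> M \<phi> = restrict (ultrapower_state \<omega> \<phi>) (relative_commutant \<omega> M \<phi>)"

end

theory Submission
  imports Defs
begin

text \<open>
  Let \<open>(x\<^sub>n)\<close> represent an element of \<open>M' \<inter> M\<^sup>\<omega>\<close>. Bounded sets of operators are compact in the weak
  operator topology, so \<open>(x\<^sub>n)\<close> has a weak limit \<open>z\<close> along \<open>\<omega>\<close>, and \<open>z\<close> lies in \<open>M\<close>. For \<open>a\<close> in \<open>M\<close>,
  commutation in the ultrapower says that \<open>a x\<^sub>n - x\<^sub>n a\<close> tends strongly to \<open>0\<close>; its weak limit is
  \<open>a z - z a\<close>, so \<open>z\<close> is central. Normal functionals are continuous along bounded weakly convergent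
  sequences, so \<open>\<phi>\<^sup>\<omega>\<close> and \<open>\<psi>\<^sup>\<omega>\<close> take the values \<open>\<phi> z\<close> and \<open>\<psi> z\<close> at the class of \<open>(x\<^sub>n)\<close>, and these
  agree because \<open>z\<close> is central (\<open>relative_commutant_limit_central\<close>).

  The two restricted states must also have the same domain, that is, the ultrapower must not
  depend on the state. This holds because a bounded sequence in \<open>M\<close> is null for the seminorm of
  any normal faithful state exactly if it tends to \<open>0\<close> strongly together with its adjoints
  (\<open>null_seqs_eq\<close>). The description by strong convergence also makes the coset computations in the
  ultrapower elementary.

  The analytic input is weak compactness along an ultrafilter (\<open>weak_limit_exists\<close>), which comes from
  the Riesz representation theorem; the latter also provides adjoints. Most of the Hilbert space
  work is done with the real inner product: complex-linearity and the complex inner product are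
  recovered from it by applying it to \<open>-\<i>\<close> times a vector.
\<close>

section \<open>Riesz representation in real Hilbert spaces\<close>

text \<open>The representing vector is the minimiser of \<open>J x = \<parallel>x\<parallel>\<^sup>2 - 2 f x\<close>: if \<open>f = \<langle>v, -\<rangle>\<close>, then \<open>J x\<close> is
  \<open>\<parallel>x - v\<parallel>\<^sup>2 - \<parallel>v\<parallel>\<^sup>2\<close>. By the parallelogram law a minimising sequence is Cauchy, and the first-order
  condition at the minimiser is the representation of \<open>f\<close>.\<close>

lemma riesz_representation:
  fixes f :: "'a::{real_inner,complete_space} \<Rightarrow> real"
  assumes "bounded_linear f"
  obtains v where "\<And>y. f y = v \<bullet> y"
proof -
  interpret f: bounded_linear f by fact
  obtain K where K: "\<And>x. norm (f x) \<le> norm x * K" "K \<ge> 0"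
    using f.nonneg_bounded by blast
  define J where "J x = (norm x)\<^sup>2 - 2 * f x" for x
  have J_ge: "J x \<ge> - K\<^sup>2" for x
  proof -
    have "2 * f x \<le> 2 * (norm x * K)" using K(1)[of x] by simp
    also have "\<dots> \<le> (norm x)\<^sup>2 + K\<^sup>2"
      using sum_squares_bound[of "norm x" K] by simp
    finally show ?thesis by (simp add: J_def)
  qed
  define m where "m = Inf (range J)"
  have bdd: "bdd_below (range J)" using J_ge by (auto intro!: bdd_belowI[of _ "- K\<^sup>2"])
  have m_le: "m \<le> J x" for x unfolding m_def using bdd by (auto intro: cINF_lower)
  have "\<exists>x. J x < m + inverse (real (Suc n))" for n
    using cInf_lessD[of "range J" "m + inverse (real (Suc n))"] by (auto simp: m_def)
  then obtain u where u: "\<And>n. J (u n) < m + inverse (real (Suc n))" by metis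
  have close: "(norm (x - y))\<^sup>2 \<le> 2 * (J x - m) + 2 * (J y - m)" for x y
  proof -
    have plus: "(norm (x + y))\<^sup>2 = (norm x)\<^sup>2 + 2 * (x \<bullet> y) + (norm y)\<^sup>2"
      and minus: "(norm (x - y))\<^sup>2 = (norm x)\<^sup>2 - 2 * (x \<bullet> y) + (norm y)\<^sup>2"
      by (simp_all add: power2_norm_eq_inner inner_add_left inner_add_right
          inner_diff_left inner_diff_right inner_commute[of y x])
    define h where "h = (1/2) *\<^sub>R (x + y)"
    have "J h = (norm (x + y))\<^sup>2 / 4 - (f x + f y)"
      by (simp add: h_def J_def f.scaleR f.add power_divide add_divide_distrib)
    then have "J x + J y - 2 * J h = (norm (x - y))\<^sup>2 / 2"
      using J_def[of x] J_def[of y] plus minus by linarith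
    then show ?thesis using m_le[of h] by (simp add: field_simps)
  qed
  have "Cauchy u"
  proof (rule metric_CauchyI)
    fix e :: real assume "0 < e"
    then have "0 < e\<^sup>2 / 4" by simp
    then obtain N where N: "inverse (real (Suc N)) < e\<^sup>2 / 4"
      using reals_Archimedean by blast
    have *: "J (u n) - m < e\<^sup>2 / 4" if "n \<ge> N" for n
    proof -
      have "inverse (real (Suc n)) \<le> inverse (real (Suc N))" using that by simp
      then show ?thesis using u[of n] N by linarith
    qed
    have "dist (u n) (u k) < e" if "n \<ge> N" "k \<ge> N" for n k
    proof -
      have "(norm (u n - u k))\<^sup>2 < e\<^sup>2"
        using close[of "u n" "u k"] *[OF that(1)] *[OF that(2)] by (simp add: field_simps)
      then show ?thesis
        using \<open>0 < e\<close> by (simp add: dist_norm power_less_imp_less_base)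
    qed
    then show "\<exists>N. \<forall>n\<ge>N. \<forall>k\<ge>N. dist (u n) (u k) < e" by blast
  qed
  then obtain v where v: "u \<longlonglongrightarrow> v"
    using Cauchy_convergent_iff convergent_def by metis
  have "(\<lambda>n. J (u n)) \<longlonglongrightarrow> J v"
    unfolding J_def by (intro tendsto_intros v f.tendsto)
  moreover have "(\<lambda>n. m + inverse (real (Suc n))) \<longlonglongrightarrow> m + 0"
    by (intro tendsto_intros LIMSEQ_inverse_real_of_nat)
  ultimately have "J v \<le> m + 0"
    using u by (intro LIMSEQ_le) (auto intro: less_imp_le)
  then have min: "J v \<le> J x" for x using m_le[of x] by simp
  have "f y = v \<bullet> y" for y
  proof -
    define d where "d = v \<bullet> y - f y"
    have quad: "0 \<le> t\<^sup>2 * (norm y)\<^sup>2 + 2 * t * d" for t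
    proof -
      have "(norm (v + t *\<^sub>R y))\<^sup>2 = (norm v)\<^sup>2 + 2 * t * (v \<bullet> y) + t\<^sup>2 * (norm y)\<^sup>2"
        by (simp add: power2_norm_eq_inner inner_add_left inner_add_right inner_commute[of y v]
            power2_eq_square[of t] distrib_left mult.assoc)
      then have "J (v + t *\<^sub>R y) - J v = t\<^sup>2 * (norm y)\<^sup>2 + 2 * t * d"
        by (simp add: J_def d_def f.scaleR f.add algebra_simps)
      then show ?thesis using min[of "v + t *\<^sub>R y"] by simp
    qed
    define q where "q = (norm y)\<^sup>2 + 1"
    have "q > 0" unfolding q_def by (simp add: add_nonneg_pos)
    \<comment> \<open>Adding \<open>1\<close> to \<open>\<parallel>y\<parallel>\<^sup>2\<close> allows the step \<open>- d / q\<close> for \<open>y = 0\<close> too.\<close>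
    have "0 \<le> (d / q)\<^sup>2 * (q - 1) - 2 * (d / q) * d"
      using quad[of "- (d / q)"] by (simp add: q_def)
    then have "0 \<le> ((d / q)\<^sup>2 * (q - 1) - 2 * (d / q) * d) * q\<^sup>2" by simp
    also have "\<dots> = - (d\<^sup>2 * (q + 1))"
      using \<open>q > 0\<close> by (simp add: field_simps power2_eq_square)
    finally have "d\<^sup>2 * (q + 1) \<le> 0" by simp
    then have "d = 0" using \<open>q > 0\<close> by (simp add: mult_le_0_iff)
    then show ?thesis by (simp add: d_def)
  qed
  then show thesis by (rule that)
qed

lemma inner_eqI: "(\<And>y. a \<bullet> y = b \<bullet> y) \<Longrightarrow> a = (b::'a::real_inner)"
  using vector_eq_rdot by blast

text \<open>Riesz applied in one variable at a time. It yields both adjoints of operators and weak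
  limits of bounded sequences of operators.\<close>

lemma bilinear_form_representation:
  fixes b :: "'a::{real_inner,complete_space} \<Rightarrow> 'a \<Rightarrow> real"
  assumes "bounded_bilinear b"
  obtains Z :: "'a \<Rightarrow>\<^sub>L 'a" where "\<And>x y. Z x \<bullet> y = b x y"
proof -
  interpret b: bounded_bilinear b by fact
  obtain K where K: "K \<ge> 0" "\<And>x y. norm (b x y) \<le> norm x * norm y * K"
    using b.nonneg_bounded by blast
  have "\<exists>v. \<forall>y. b x y = v \<bullet> y" for x
    using riesz_representation[OF b.bounded_linear_right[of x]] by metis
  then obtain Z where Z: "\<And>x y. b x y = Z x \<bullet> y" by metis
  have "bounded_linear Z"
  proof (rule bounded_linear_intro)
    show "Z (x + y) = Z x + Z y" for x y
      by (rule inner_eqI) (simp add: inner_add_left b.add_left flip: Z)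
    show "Z (r *\<^sub>R x) = r *\<^sub>R Z x" for r x
      by (rule inner_eqI) (simp add: b.scaleR_left flip: Z)
    show "norm (Z x) \<le> norm x * K" for x
    proof (cases "Z x = 0")
      case False
      have "norm (Z x) * norm (Z x) \<le> norm x * K * norm (Z x)"
        using K(2)[of x "Z x"] by (simp add: Z power2_norm_eq_inner[symmetric] power2_eq_square mult_ac)
      then show ?thesis using False by simp
    qed (simp add: K)
  qed
  then show thesis using that[of "Blinfun Z"] by (simp add: bounded_linear_Blinfun_apply Z)
qed

section \<open>Weak and strong limits along an ultrafilter\<close>

lemma free_ultrafilterD:
  assumes "free_ultrafilter \<omega>"
  shows "\<omega> \<noteq> bot" "eventually P \<omega> \<or> eventually (\<lambda>n. \<not> P n) \<omega>"
  using assms by (auto simp: free_ultrafilter_def)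

lemma ultrafilter_bounded_convergent:
  fixes X :: "nat \<Rightarrow> 'a::heine_borel"
  assumes \<omega>: "free_ultrafilter \<omega>" and X: "bounded (range X)"
  obtains l where "(X \<longlongrightarrow> l) \<omega>"
proof -
  have "compact (closure (range X))" using X by (simp add: compact_closure)
  moreover have "filtermap X \<omega> \<noteq> bot"
    using free_ultrafilterD(1)[OF \<omega>] by (simp add: filtermap_bot_iff)
  moreover have "eventually (\<lambda>x. x \<in> closure (range X)) (filtermap X \<omega>)"
    by (simp add: eventually_filtermap closure_subset[THEN subsetD])
  ultimately obtain l where l: "inf (nhds l) (filtermap X \<omega>) \<noteq> bot"
    unfolding compact_filter by blast
  have "(X \<longlongrightarrow> l) \<omega>"
  proof (rule topological_tendstoI)
    fix V assume V: "open V" "l \<in> V"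
    show "eventually (\<lambda>n. X n \<in> V) \<omega>"
    proof (rule ccontr)
      assume "\<not> eventually (\<lambda>n. X n \<in> V) \<omega>"
      then have "eventually (\<lambda>x. x \<notin> V) (filtermap X \<omega>)"
        using free_ultrafilterD(2)[OF \<omega>] by (auto simp: eventually_filtermap)
      moreover have "eventually (\<lambda>x. x \<in> V) (nhds l)"
        using V by (auto simp: eventually_nhds)
      ultimately have "eventually (\<lambda>x. False) (inf (nhds l) (filtermap X \<omega>))"
        unfolding eventually_inf by blast
      then show False using l by (simp add: trivial_limit_def)
    qed
  qed
  then show thesis by (rule that)
qed

text \<open>Convergence in the weak operator topology; the real inner product suffices, since on
  complex-linear operators it controls the complex one (\<open>tends_weakly_cinner\<close>).\<close>

definition tends_weakly ::
    "(nat \<Rightarrow> ('a::real_inner \<Rightarrow>\<^sub>L 'a)) \<Rightarrow> ('a \<Rightarrow>\<^sub>L 'a) \<Rightarrow> nat filter \<Rightarrow> bool" where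
  "tends_weakly x z F \<longleftrightarrow> (\<forall>\<xi> \<eta>. ((\<lambda>n. x n \<xi> \<bullet> \<eta>) \<longlongrightarrow> z \<xi> \<bullet> \<eta>) F)"

lemma bounded_range_blinfun:
  fixes x :: "nat \<Rightarrow> ('a::real_normed_vector \<Rightarrow>\<^sub>L 'b::real_normed_vector)"
  assumes "bounded (range x)"
  obtains K where "K \<ge> 0" "\<And>n \<xi>. norm (x n \<xi>) \<le> K * norm \<xi>"
proof -
  obtain K where K: "\<And>n. norm (x n) \<le> K" using assms by (auto simp: bounded_iff)
  have "norm (x n \<xi>) \<le> K * norm \<xi>" for n \<xi>
    using norm_blinfun[of "x n" \<xi>] K[of n] by (meson mult_right_mono norm_ge_zero order_trans)
  then show thesis using that order_trans[OF norm_ge_zero K] by blast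
qed

text \<open>Each matrix coefficient is a bounded scalar sequence and converges along the ultrafilter; the
  limits form a bounded bilinear form, which represents the limit operator.\<close>

lemma weak_limit_exists:
  fixes x :: "nat \<Rightarrow> ('a::{real_inner,complete_space} \<Rightarrow>\<^sub>L 'a)"
  assumes \<omega>: "free_ultrafilter \<omega>" and x: "bounded (range x)"
  obtains z where "tends_weakly x z \<omega>"
proof -
  note nt = free_ultrafilterD(1)[OF \<omega>]
  obtain K where K: "K \<ge> 0" "\<And>n \<xi>. norm (x n \<xi>) \<le> K * norm \<xi>"
    using bounded_range_blinfun[OF x] by blast
  have bd: "norm (x n \<xi> \<bullet> \<eta>) \<le> norm \<xi> * norm \<eta> * K" for n \<xi> \<eta>
  proof -
    have "norm (x n \<xi> \<bullet> \<eta>) \<le> norm (x n \<xi>) * norm \<eta>" using Cauchy_Schwarz_ineq2 by simp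
    also have "\<dots> \<le> (K * norm \<xi>) * norm \<eta>" using K(2) by (intro mult_right_mono) auto
    finally show ?thesis by (simp add: mult_ac)
  qed
  have "\<exists>l. ((\<lambda>n. x n \<xi> \<bullet> \<eta>) \<longlongrightarrow> l) \<omega>" for \<xi> \<eta>
  proof -
    have "bounded (range (\<lambda>n. x n \<xi> \<bullet> \<eta>))" using bd by (auto simp: bounded_iff)
    then show ?thesis using ultrafilter_bounded_convergent[OF \<omega>] by metis
  qed
  then obtain b where b: "\<And>\<xi> \<eta>. ((\<lambda>n. x n \<xi> \<bullet> \<eta>) \<longlongrightarrow> b \<xi> \<eta>) \<omega>" by metis
  have "bounded_bilinear b"
  proof
    show "b (\<xi> + \<xi>') \<eta> = b \<xi> \<eta> + b \<xi>' \<eta>" for \<xi> \<xi>' \<eta>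
      using tendsto_add[OF b[of \<xi> \<eta>] b[of \<xi>' \<eta>]] b[of "\<xi> + \<xi>'" \<eta>]
      by (intro tendsto_unique[OF nt]) (simp_all add: blinfun.add_right inner_add_left)
    show "b \<xi> (\<eta> + \<eta>') = b \<xi> \<eta> + b \<xi> \<eta>'" for \<xi> \<eta> \<eta>'
      using tendsto_add[OF b[of \<xi> \<eta>] b[of \<xi> \<eta>']] b[of \<xi> "\<eta> + \<eta>'"]
      by (intro tendsto_unique[OF nt]) (simp_all add: inner_add_right)
    show "b (r *\<^sub>R \<xi>) \<eta> = r *\<^sub>R b \<xi> \<eta>" for r \<xi> \<eta>
      using tendsto_mult_left[OF b[of \<xi> \<eta>], of r] b[of "r *\<^sub>R \<xi>" \<eta>]
      by (intro tendsto_unique[OF nt]) (simp_all add: blinfun.scaleR_right)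
    show "b \<xi> (r *\<^sub>R \<eta>) = r *\<^sub>R b \<xi> \<eta>" for r \<xi> \<eta>
      using tendsto_mult_left[OF b[of \<xi> \<eta>], of r] b[of \<xi> "r *\<^sub>R \<eta>"]
      by (intro tendsto_unique[OF nt]) simp_all
    show "\<exists>K. \<forall>\<xi> \<eta>. norm (b \<xi> \<eta>) \<le> norm \<xi> * norm \<eta> * K"
      using tendsto_upperbound[OF tendsto_norm[OF b] always_eventually nt] bd by blast
  qed
  then obtain Z :: "'a \<Rightarrow>\<^sub>L 'a" where "\<And>x y. Z x \<bullet> y = b x y"
    using bilinear_form_representation by blast
  then show thesis using b by (intro that[of Z]) (simp add: tends_weakly_def)
qed

lemma tends_weakly_unique:
  assumes "F \<noteq> bot" "tends_weakly x z F" "tends_weakly x z' F"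
  shows "z = z'"
proof (rule blinfun_eqI, rule inner_eqI)
  show "z \<xi> \<bullet> \<eta> = z' \<xi> \<bullet> \<eta>" for \<xi> \<eta>
    using tendsto_unique[OF assms(1)] assms(2,3) unfolding tends_weakly_def by blast
qed

lemma tends_weakly_diff:
  assumes "tends_weakly x z F" "tends_weakly y w F"
  shows "tends_weakly (\<lambda>n. x n - y n) (z - w) F"
  using assms unfolding tends_weakly_def
  by (simp add: blinfun.diff_left inner_diff_left tendsto_diff)

lemma tends_weakly_compose_right:
  assumes "tends_weakly x z F"
  shows "tends_weakly (\<lambda>n. x n o\<^sub>L a) (z o\<^sub>L a) F"
  using assms by (simp add: tends_weakly_def)

definition tends_strongly_0 ::
    "(nat \<Rightarrow> ('a::real_normed_vector \<Rightarrow>\<^sub>L 'a)) \<Rightarrow> nat filter \<Rightarrow> bool" where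
  "tends_strongly_0 x F \<longleftrightarrow> (\<forall>\<xi>. ((\<lambda>n. x n \<xi>) \<longlongrightarrow> 0) F)"

lemma tends_strongly_0_imp_weakly: "tends_strongly_0 x F \<Longrightarrow> tends_weakly x 0 F"
  unfolding tends_strongly_0_def tends_weakly_def
  by (auto intro: tendsto_eq_intros)

lemma tends_strongly_0_add:
  "tends_strongly_0 x F \<Longrightarrow> tends_strongly_0 y F \<Longrightarrow> tends_strongly_0 (\<lambda>n. x n + y n) F"
  unfolding tends_strongly_0_def by (auto simp: blinfun.add_left intro: tendsto_eq_intros)

lemma tends_strongly_0_diff:
  "tends_strongly_0 x F \<Longrightarrow> tends_strongly_0 y F \<Longrightarrow> tends_strongly_0 (\<lambda>n. x n - y n) F"
  unfolding tends_strongly_0_def by (auto simp: blinfun.diff_left intro: tendsto_eq_intros)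

lemma tends_strongly_0_compose_right:
  "tends_strongly_0 x F \<Longrightarrow> tends_strongly_0 (\<lambda>n. x n o\<^sub>L a) F"
  by (simp add: tends_strongly_0_def)

text \<open>Composition is asymmetric here: a bounded left factor may vary with the index, whereas a varying
  right factor moves the vector and can destroy strong convergence.\<close>

lemma tends_strongly_0_compose_left:
  assumes y: "tends_strongly_0 y F" and x: "bounded (range x)"
  shows "tends_strongly_0 (\<lambda>n. x n o\<^sub>L y n) F"
  unfolding tends_strongly_0_def
proof
  fix \<xi>
  obtain K where K: "\<And>n \<xi>. norm (x n \<xi>) \<le> K * norm \<xi>"
    using bounded_range_blinfun[OF x] by metis
  have "((\<lambda>n. norm (y n \<xi>) * K) \<longlongrightarrow> 0) F"
    using y unfolding tends_strongly_0_def
    by (intro tendsto_mult_left_zero tendsto_norm_zero) simp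
  then show "((\<lambda>n. (x n o\<^sub>L y n) \<xi>) \<longlongrightarrow> 0) F"
    by (rule Lim_null_comparison[rotated]) (simp add: K mult.commute)
qed

section \<open>Complex-linear operators and adjoints\<close>

lemmas blinfun_compose_distribs =
  bounded_bilinear.add_left[OF bounded_bilinear_blinfun_compose]
  bounded_bilinear.add_right[OF bounded_bilinear_blinfun_compose]
  bounded_bilinear.diff_left[OF bounded_bilinear_blinfun_compose]

lemma blinfun_compose_assoc: "(a o\<^sub>L b) o\<^sub>L c = a o\<^sub>L (b o\<^sub>L c)"
  by (rule blinfun_eqI) simp

text \<open>This identity reduces statements on the complex inner product to the real one.\<close>

lemma Im_cinner: "Im (cinner x y) = ((- \<i>) *\<^sub>C x) \<bullet> (y::'h::complex_hilbert_space)"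
  by (simp add: cinner_scaleC_left flip: Re_cinner)

lemma cinner_eqI: "(\<And>x. cinner x y = cinner x y') \<Longrightarrow> y = (y'::'h::complex_hilbert_space)"
  by (rule inner_eqI) (metis Re_cinner inner_commute)

lemma cinner_add_right: "cinner x (y + z) = cinner x y + cinner x (z::'h::complex_hilbert_space)"
  by (metis cinner_add_left cinner_commute complex_cnj_add)

lemma cinner_zero: "cinner 0 x = 0" "cinner x 0 = (0::complex)" for x :: "'h::complex_hilbert_space"
proof -
  show "cinner 0 x = 0" using cinner_add_left[of 0 0 x] by simp
  then show "cinner x 0 = 0" using cinner_commute[of x 0] by simp
qed

text \<open>Rotate \<open>x\<close> by a phase \<open>c\<close> that makes the inner product real, then use the real
  Cauchy--Schwarz inequality.\<close>

lemma cinner_le: "cmod (cinner x y) \<le> norm x * norm (y::'h::complex_hilbert_space)"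
proof (cases "cinner x y = 0")
  case False
  define c where "c = cnj (cinner x y) / cmod (cinner x y)"
  have "cmod c = 1" using False by (simp add: c_def norm_divide)
  have "c * cinner x y = cmod (cinner x y)"
    using False by (simp add: c_def complex_norm_square[symmetric] mult.commute power2_eq_square)
  then have "cmod (cinner x y) = (c *\<^sub>C x) \<bullet> y"
    by (simp add: cinner_scaleC_left flip: Re_cinner)
  also have "\<dots> \<le> norm (c *\<^sub>C x) * norm y" by (rule norm_cauchy_schwarz)
  finally show ?thesis by (simp add: norm_scaleC \<open>cmod c = 1\<close>)
qed simp

lemma bounded_opsD: "T \<in> bounded_ops \<Longrightarrow> T (c *\<^sub>C x) = c *\<^sub>C T x"
  by (simp add: bounded_ops_def)

lemma id_bounded_ops: "id_blinfun \<in> bounded_ops"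
  by (simp add: bounded_ops_def)

lemma bounded_ops_compose: "S \<in> bounded_ops \<Longrightarrow> T \<in> bounded_ops \<Longrightarrow> S o\<^sub>L T \<in> bounded_ops"
  by (simp add: bounded_ops_def)

lemma bounded_ops_add: "S \<in> bounded_ops \<Longrightarrow> T \<in> bounded_ops \<Longrightarrow> S + T \<in> bounded_ops"
  by (simp add: bounded_ops_def blinfun.add_left scaleC_add_right)

lemma bounded_ops_scaleC: "T \<in> bounded_ops \<Longrightarrow> scaleC_op c T \<in> bounded_ops"
  by (simp add: bounded_ops_def scaleC_op.rep_eq scaleC_scaleC mult.commute)

text \<open>The real adjoint serves: it agrees with the complex one in the imaginary part because
  the operator commutes with multiplication by \<open>-\<i>\<close>.\<close>

lemma ex1_adjoint:
  fixes T :: "'h::complex_hilbert_space \<Rightarrow>\<^sub>L 'h"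
  assumes T: "T \<in> bounded_ops"
  shows "\<exists>!S :: 'h \<Rightarrow>\<^sub>L 'h. \<forall>x y. cinner (T x) y = cinner x (S y)"
proof (rule ex_ex1I)
  have "bounded_bilinear (\<lambda>y x. T x \<bullet> y)"
    by (rule bounded_bilinear.flip,
        rule bounded_bilinear.comp1[OF bounded_bilinear_inner blinfun.bounded_linear_right])
  then obtain S :: "'h \<Rightarrow>\<^sub>L 'h" where S: "\<And>y x. S y \<bullet> x = T x \<bullet> y"
    using bilinear_form_representation by blast
  have "cinner (T x) y = cinner x (S y)" for x y
  proof (rule complex_eqI)
    show "Re (cinner (T x) y) = Re (cinner x (S y))"
      unfolding Re_cinner by (metis S inner_commute)
    have "(- \<i>) *\<^sub>C T x = T ((- \<i>) *\<^sub>C x)" using T by (simp add: bounded_ops_def)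
    then show "Im (cinner (T x) y) = Im (cinner x (S y))"
      unfolding Im_cinner by (metis S inner_commute)
  qed
  then show "\<exists>S :: 'h \<Rightarrow>\<^sub>L 'h. \<forall>x y. cinner (T x) y = cinner x (S y)" by blast
next
  fix S S' :: "'h \<Rightarrow>\<^sub>L 'h"
  assume "\<forall>x y. cinner (T x) y = cinner x (S y)" "\<forall>x y. cinner (T x) y = cinner x (S' y)"
  then show "S = S'" by (intro blinfun_eqI cinner_eqI) metis
qed

lemma cinner_adj:
  assumes "T \<in> bounded_ops"
  shows "cinner (T x) y = cinner x (adj T y)"
  using theI'[OF ex1_adjoint[OF assms]] unfolding adj_def by blast

lemma inner_adj: "T \<in> bounded_ops \<Longrightarrow> T x \<bullet> y = x \<bullet> adj T y"
  using cinner_adj[of T x y] by (simp flip: Re_cinner)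

lemma adj_eqI:
  fixes S T :: "'h::complex_hilbert_space \<Rightarrow>\<^sub>L 'h"
  assumes "T \<in> bounded_ops" "\<And>x y. cinner (T x) y = cinner x (S y)"
  shows "adj T = S"
  unfolding adj_def using ex1_adjoint[OF assms(1)] assms(2) by (intro the1_equality) auto

lemma adj_bounded_ops:
  assumes "T \<in> bounded_ops" shows "adj T \<in> bounded_ops"
  unfolding bounded_ops_def
proof (intro CollectI allI, rule cinner_eqI)
  show "cinner u (adj T (c *\<^sub>C x)) = cinner u (c *\<^sub>C adj T x)" for c x u
    by (simp add: cinner_adj[OF assms, symmetric] cinner_scaleC_right)
qed

lemma adj_adj:
  assumes "T \<in> bounded_ops" shows "adj (adj T) = T"
proof (rule adj_eqI[OF adj_bounded_ops[OF assms]])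
  show "cinner (adj T x) y = cinner x (T y)" for x y
    using cinner_adj[OF assms, of y x] cinner_commute[of "adj T x" y] cinner_commute[of x "T y"]
    by simp
qed

lemma adj_compose:
  assumes "S \<in> bounded_ops" "T \<in> bounded_ops"
  shows "adj (S o\<^sub>L T) = adj T o\<^sub>L adj S"
  by (rule adj_eqI) (simp_all add: assms bounded_ops_compose cinner_adj)

lemma adj_add:
  assumes "S \<in> bounded_ops" "T \<in> bounded_ops"
  shows "adj (S + T) = adj S + adj T"
  by (rule adj_eqI)
    (simp_all add: assms bounded_ops_add cinner_adj blinfun.add_left cinner_add_left cinner_add_right)

lemma adj_scaleC:
  assumes "T \<in> bounded_ops"
  shows "adj (scaleC_op c T) = scaleC_op (cnj c) (adj T)"
  by (rule adj_eqI)
    (simp_all add: assms bounded_ops_scaleC cinner_adj scaleC_op.rep_eq cinner_scaleC_left cinner_scaleC_right)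

lemma norm_adj_le:
  assumes "T \<in> bounded_ops" shows "norm (adj T) \<le> norm T"
proof (rule norm_blinfun_bound)
  fix y
  have "norm (adj T y) * norm (adj T y) = T (adj T y) \<bullet> y"
    unfolding inner_adj[OF assms] by (metis power2_norm_eq_inner power2_eq_square)
  also have "\<dots> \<le> norm (T (adj T y)) * norm y" by (rule norm_cauchy_schwarz)
  also have "\<dots> \<le> norm T * norm (adj T y) * norm y"
    by (intro mult_right_mono norm_blinfun) simp
  finally have "norm (adj T y) * norm (adj T y) \<le> norm T * norm y * norm (adj T y)"
    by (simp add: ac_simps)
  then show "norm (adj T y) \<le> norm T * norm y" by (cases "adj T y = 0") auto
qed simp

lemma tends_weakly_compose_left:
  assumes "tends_weakly x z F" "a \<in> bounded_ops"
  shows "tends_weakly (\<lambda>n. a o\<^sub>L x n) (a o\<^sub>L z) F"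
  using assms by (simp add: tends_weakly_def inner_adj)

text \<open>The diagonal matrix coefficients of \<open>x\<^sub>n\<^sup>* x\<^sub>n\<close> are \<open>\<parallel>x\<^sub>n \<xi>\<parallel>\<^sup>2\<close>.\<close>

lemma tends_weakly_square_iff:
  fixes x :: "nat \<Rightarrow> ('h::complex_hilbert_space \<Rightarrow>\<^sub>L 'h)"
  assumes x: "\<And>n. x n \<in> bounded_ops"
  shows "tends_weakly (\<lambda>n. adj (x n) o\<^sub>L x n) 0 F \<longleftrightarrow> tends_strongly_0 x F"
proof
  have sq: "adj (x n) (x n \<xi>) \<bullet> \<eta> = x n \<xi> \<bullet> x n \<eta>" for n \<xi> \<eta>
    using inner_adj[OF x, of n \<eta> "x n \<xi>"] by (simp add: inner_commute)
  show "tends_strongly_0 x F" if "tends_weakly (\<lambda>n. adj (x n) o\<^sub>L x n) 0 F"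
    unfolding tends_strongly_0_def
  proof
    fix \<xi>
    have "((\<lambda>n. (norm (x n \<xi>))\<^sup>2) \<longlongrightarrow> 0) F"
      using that by (simp add: tends_weakly_def sq power2_norm_eq_inner)
    then have "((\<lambda>n. sqrt ((norm (x n \<xi>))\<^sup>2)) \<longlongrightarrow> sqrt 0) F" by (rule tendsto_real_sqrt)
    then show "((\<lambda>n. x n \<xi>) \<longlongrightarrow> 0) F" by (simp add: tendsto_norm_zero_iff)
  qed
  show "tends_weakly (\<lambda>n. adj (x n) o\<^sub>L x n) 0 F" if "tends_strongly_0 x F"
    unfolding tends_weakly_def
  proof (intro allI)
    fix \<xi> \<eta>
    have "((\<lambda>n. x n \<xi> \<bullet> x n \<eta>) \<longlongrightarrow> (0::'h) \<bullet> (0::'h)) F"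
      using that unfolding tends_strongly_0_def by (intro tendsto_inner) simp_all
    then show "((\<lambda>n. (adj (x n) o\<^sub>L x n) \<xi> \<bullet> \<eta>) \<longlongrightarrow> blinfun_apply 0 \<xi> \<bullet> \<eta>) F"
      by (simp add: sq)
  qed
qed

section \<open>Closure properties of von Neumann algebras\<close>

lemma tends_weakly_commute:
  assumes F: "F \<noteq> bot" and x: "tends_weakly x z F"
    and a: "a \<in> bounded_ops" and comm: "\<And>n. x n o\<^sub>L a = a o\<^sub>L x n"
  shows "z o\<^sub>L a = a o\<^sub>L z"
  using tends_weakly_unique[OF F tends_weakly_compose_right[OF x]]
    tends_weakly_compose_left[OF x a] by (simp add: comm)

text \<open>Complex-linearity is commutation with the scalar operators, so it passes to weak limits
  as commutation with any fixed complex-linear operator does.\<close>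

lemma bounded_ops_weak_limit:
  assumes F: "F \<noteq> bot" and x: "tends_weakly x z F" and xn: "\<And>n. x n \<in> bounded_ops"
  shows "z \<in> bounded_ops"
  unfolding bounded_ops_def
proof (intro CollectI allI)
  fix c \<xi>
  have "x n o\<^sub>L scaleC_op c id_blinfun = scaleC_op c id_blinfun o\<^sub>L x n" for n
    by (rule blinfun_eqI) (simp add: scaleC_op.rep_eq bounded_opsD[OF xn])
  then have "z o\<^sub>L scaleC_op c id_blinfun = scaleC_op c id_blinfun o\<^sub>L z"
    by (intro tends_weakly_commute[OF F x] bounded_ops_scaleC id_bounded_ops)
  from arg_cong[OF this, of "\<lambda>T. blinfun_apply T \<xi>"]
  show "z (c *\<^sub>C \<xi>) = c *\<^sub>C z \<xi>" by (simp add: scaleC_op.rep_eq)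
qed

lemma commutant_weak_limit:
  assumes F: "F \<noteq> bot" and x: "tends_weakly x z F"
    and A: "A \<subseteq> bounded_ops" and xn: "\<And>n. x n \<in> commutant A"
  shows "z \<in> commutant A"
  using bounded_ops_weak_limit[OF F x] tends_weakly_commute[OF F x] A xn
  unfolding commutant_def by blast

lemma commutant_bounded_ops: "commutant A \<subseteq> bounded_ops"
  by (auto simp: commutant_def)

lemma commutant_add: "S \<in> commutant A \<Longrightarrow> T \<in> commutant A \<Longrightarrow> S + T \<in> commutant A"
  by (auto simp: commutant_def bounded_ops_add blinfun_compose_distribs)

lemma commutant_compose:
  assumes S: "S \<in> commutant A" and T: "T \<in> commutant A"
  shows "S o\<^sub>L T \<in> commutant A"
proof -
  have "S o\<^sub>L T o\<^sub>L R = R o\<^sub>L (S o\<^sub>L T)" if "R \<in> A" for R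
  proof -
    have "S o\<^sub>L T o\<^sub>L R = S o\<^sub>L R o\<^sub>L T"
      using T that by (simp add: commutant_def blinfun_compose_assoc)
    also have "\<dots> = R o\<^sub>L (S o\<^sub>L T)"
      using S that by (simp add: commutant_def blinfun_compose_assoc)
    finally show ?thesis .
  qed
  then show ?thesis using S T by (simp add: commutant_def bounded_ops_compose)
qed

lemma commutant_scaleC:
  assumes "A \<subseteq> bounded_ops" "T \<in> commutant A" shows "scaleC_op c T \<in> commutant A"
proof -
  have "scaleC_op c T o\<^sub>L S = S o\<^sub>L scaleC_op c T" if "S \<in> A" for S
  proof (rule blinfun_eqI)
    fix \<xi>
    have "T o\<^sub>L S = S o\<^sub>L T" using assms(2) that by (simp add: commutant_def)
    from arg_cong[OF this, of "\<lambda>R. blinfun_apply R \<xi>"]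
    have "T (S \<xi>) = S (T \<xi>)" by simp
    then show "(scaleC_op c T o\<^sub>L S) \<xi> = (S o\<^sub>L scaleC_op c T) \<xi>"
      using assms(1) that by (simp add: scaleC_op.rep_eq bounded_opsD subset_iff)
  qed
  then show ?thesis using assms by (auto simp: commutant_def bounded_ops_scaleC)
qed

text \<open>Closure under adjoints is part of the definition. The rest holds for the commutant of any set
  of complex-linear operators, and \<open>M\<close> is the commutant of its own commutant.\<close>

lemma von_neumann_algebra_closed:
  assumes M: "von_neumann_algebra M"
  shows von_neumann_algebra_bounded_ops: "x \<in> M \<Longrightarrow> x \<in> bounded_ops"
    and von_neumann_algebra_adj: "x \<in> M \<Longrightarrow> adj x \<in> M"
    and von_neumann_algebra_add: "x \<in> M \<Longrightarrow> y \<in> M \<Longrightarrow> x + y \<in> M"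
    and von_neumann_algebra_compose: "x \<in> M \<Longrightarrow> y \<in> M \<Longrightarrow> x o\<^sub>L y \<in> M"
    and von_neumann_algebra_scaleC: "x \<in> M \<Longrightarrow> scaleC_op c x \<in> M"
    and von_neumann_algebra_id: "id_blinfun \<in> M"
    and von_neumann_algebra_weak_limit:
      "F \<noteq> bot \<Longrightarrow> tends_weakly X z F \<Longrightarrow> (\<And>n. X n \<in> M) \<Longrightarrow> z \<in> M"
proof -
  have M': "commutant (commutant M) = M" using M by (simp add: von_neumann_algebra_def)
  show "x \<in> M \<Longrightarrow> x \<in> bounded_ops" "x \<in> M \<Longrightarrow> adj x \<in> M"
    using M by (auto simp: von_neumann_algebra_def)
  show "x \<in> M \<Longrightarrow> y \<in> M \<Longrightarrow> x + y \<in> M" "x \<in> M \<Longrightarrow> y \<in> M \<Longrightarrow> x o\<^sub>L y \<in> M"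
    using commutant_add[of x "commutant M" y] commutant_compose[of x "commutant M" y]
    by (simp_all add: M')
  show "x \<in> M \<Longrightarrow> scaleC_op c x \<in> M"
    using commutant_scaleC[OF commutant_bounded_ops, of x M c] by (simp add: M')
  have "id_blinfun \<in> commutant (commutant M)"
    by (auto simp: commutant_def id_bounded_ops intro!: blinfun_eqI)
  then show "id_blinfun \<in> M" by (simp add: M')
  show "F \<noteq> bot \<Longrightarrow> tends_weakly X z F \<Longrightarrow> (\<And>n. X n \<in> M) \<Longrightarrow> z \<in> M"
    using commutant_weak_limit[OF _ _ commutant_bounded_ops, of F X z M] by (simp add: M')
qed

lemma von_neumann_algebra_zero:
  fixes M :: "('a::complex_hilbert_space \<Rightarrow>\<^sub>L 'a) set"
  assumes "von_neumann_algebra M" shows "0 \<in> M"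
proof -
  have "scaleC_op 0 id_blinfun = (0 :: 'a \<Rightarrow>\<^sub>L 'a)"
    using scaleC_of_real[of 0] by (intro blinfun_eqI) (simp add: scaleC_op.rep_eq)
  then show ?thesis
    using von_neumann_algebra_scaleC[OF assms von_neumann_algebra_id[OF assms], of 0] by simp
qed

lemma bounded_seqs_adj:
  assumes M: "von_neumann_algebra M" and x: "x \<in> bounded_seqs M"
  shows "(\<lambda>n. adj (x n)) \<in> bounded_seqs M"
proof -
  have xM: "x n \<in> M" for n using x by (simp add: bounded_seqs_def)
  obtain K where "\<And>n. norm (x n) \<le> K" using x by (auto simp: bounded_seqs_def bounded_iff)
  then have "norm (adj (x n)) \<le> K" for n
    using norm_adj_le[OF von_neumann_algebra_bounded_ops[OF M xM]] order_trans by blast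
  then show ?thesis using xM by (auto simp: bounded_seqs_def bounded_iff von_neumann_algebra_adj[OF M])
qed

lemma bounded_seqs_compose:
  assumes M: "von_neumann_algebra M" and x: "x \<in> bounded_seqs M" and y: "y \<in> bounded_seqs M"
  shows "(\<lambda>n. x n o\<^sub>L y n) \<in> bounded_seqs M"
proof -
  obtain K L where K: "\<And>n. norm (x n) \<le> K" and L: "\<And>n. norm (y n) \<le> L"
    using x y by (auto simp: bounded_seqs_def bounded_iff)
  have "norm (x n o\<^sub>L y n) \<le> K * L" for n
    using order_trans[OF norm_blinfun_compose mult_mono[OF K[of n] L[of n] order_trans[OF norm_ge_zero K]]]
    by simp
  then show ?thesis
    using x y by (auto simp: bounded_seqs_def bounded_iff von_neumann_algebra_compose[OF M])
qed

lemma bounded_seqs_const: "a \<in> M \<Longrightarrow> (\<lambda>_. a) \<in> bounded_seqs M"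
  by (simp add: bounded_seqs_def)

lemma bounded_seqs_add:
  assumes M: "von_neumann_algebra M" and x: "x \<in> bounded_seqs M" and y: "y \<in> bounded_seqs M"
  shows "(\<lambda>n. x n + y n) \<in> bounded_seqs M"
proof -
  obtain K L where K: "\<And>n. norm (x n) \<le> K" and L: "\<And>n. norm (y n) \<le> L"
    using x y by (auto simp: bounded_seqs_def bounded_iff)
  have "norm (x n + y n) \<le> K + L" for n
    using norm_triangle_mono[OF K L] .
  then show ?thesis
    using x y by (auto simp: bounded_seqs_def bounded_iff von_neumann_algebra_add[OF M])
qed

section \<open>Normal functionals along bounded sequences\<close>

lemma tends_weakly_cinner:
  assumes x: "tends_weakly x z F" and xn: "\<And>n. x n \<in> bounded_ops" and z: "z \<in> bounded_ops"
  shows "((\<lambda>n. cinner (x n \<xi>) \<eta>) \<longlongrightarrow> cinner (z \<xi>) \<eta>) F"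
  using x unfolding tendsto_complex_iff tends_weakly_def
  by (simp add: Re_cinner Im_cinner flip: bounded_opsD[OF xn] bounded_opsD[OF z])

lemma summable_norm_mult:
  assumes "square_summable \<xi>" "square_summable \<eta>"
  shows "summable (\<lambda>k. K * norm (\<xi> k) * norm (\<eta> k))"
proof -
  have "summable (\<lambda>k. norm (\<xi> k) * norm (\<eta> k))"
  proof (rule summable_comparison_test')
    show "summable (\<lambda>k. (norm (\<xi> k))\<^sup>2 + (norm (\<eta> k))\<^sup>2)"
      using assms unfolding square_summable_def by (rule summable_add)
    show "norm (norm (\<xi> k) * norm (\<eta> k)) \<le> (norm (\<xi> k))\<^sup>2 + (norm (\<eta> k))\<^sup>2" for k
    proof -
      have "0 \<le> norm (\<xi> k) * norm (\<eta> k)" by simp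
      moreover have "2 * (norm (\<xi> k) * norm (\<eta> k)) \<le> (norm (\<xi> k))\<^sup>2 + (norm (\<eta> k))\<^sup>2"
        using sum_squares_bound[of "norm (\<xi> k)" "norm (\<eta> k)"] by (simp add: mult.assoc)
      ultimately have "norm (\<xi> k) * norm (\<eta> k) \<le> (norm (\<xi> k))\<^sup>2 + (norm (\<eta> k))\<^sup>2"
        by linarith
      then show ?thesis by (simp add: abs_mult)
    qed
  qed
  then show ?thesis using summable_mult[of _ K] by (simp add: mult.assoc)
qed

text \<open>On bounded sequences weak convergence implies sigma-weak convergence: the terms of the series
  are dominated by \<open>K \<parallel>\<xi>\<^sub>k\<parallel> \<parallel>\<eta>\<^sub>k\<parallel>\<close>, so limit and sum can be exchanged by Tannery's theorem.\<close>

lemma tends_weakly_sigma_weak: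
  assumes F: "F \<noteq> bot" and x: "tends_weakly x z F" and bd: "bounded (range x)"
    and xn: "\<And>n. x n \<in> bounded_ops" and U: "openin sigma_weak_topology U" "z \<in> U"
  shows "eventually (\<lambda>n. x n \<in> U) F"
proof -
  have z: "z \<in> bounded_ops" by (rule bounded_ops_weak_limit[OF F x xn])
  obtain K where K: "\<And>n \<xi>. norm (x n \<xi>) \<le> K * norm \<xi>"
    using bounded_range_blinfun[OF bd] by metis
  have series: "((\<lambda>n. \<Sum>k. cinner (x n (\<xi> k)) (\<eta> k)) \<longlongrightarrow> (\<Sum>k. cinner (z (\<xi> k)) (\<eta> k))) F"
    if "square_summable \<xi>" "square_summable \<eta>" for \<xi> \<eta>
  proof -
    have "cmod (cinner (x n (\<xi> k)) (\<eta> k)) \<le> K * norm (\<xi> k) * norm (\<eta> k)" for n k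
      using order_trans[OF cinner_le mult_right_mono[OF K norm_ge_zero]] .
    then have "eventually (\<lambda>(k, n). cmod (cinner (x n (\<xi> k)) (\<eta> k))
        \<le> K * norm (\<xi> k) * norm (\<eta> k)) (at_top \<times>\<^sub>F F)"
      by (intro always_eventually) auto
    then show ?thesis
      using tannerys_theorem[OF tends_weakly_cinner[OF x xn z] _ summable_norm_mult[OF that] F] by blast
  qed
  have "generate_topology_on {{T \<in> bounded_ops. (\<Sum>n. cinner (blinfun_apply T (\<xi> n)) (\<eta> n)) \<in> V} | \<xi> \<eta> V.
        square_summable \<xi> \<and> square_summable \<eta> \<and> open V} U"
    using U(1) unfolding sigma_weak_topology_def by (rule openin_topology_generated_by)
  then show ?thesis using U(2)
  proof induction
    case (Int a b) then show ?case by (auto intro: eventually_conj)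
  next
    case (UN \<K>)
    then obtain k where "k \<in> \<K>" "eventually (\<lambda>n. x n \<in> k) F" by blast
    then show ?case by (auto elim: eventually_mono)
  next
    case (Basis s)
    then obtain \<xi> \<eta> V where s: "s = {T \<in> bounded_ops. (\<Sum>n. cinner (blinfun_apply T (\<xi> n)) (\<eta> n)) \<in> V}"
      and "square_summable \<xi>" "square_summable \<eta>" "open V" by blast
    then have "eventually (\<lambda>n. (\<Sum>k. cinner (x n (\<xi> k)) (\<eta> k)) \<in> V) F"
      using series Basis.prems by (intro topological_tendstoD) auto
    then show ?case using xn by (simp add: s)
  qed simp
qed

lemma bounded_ops_subset_topspace:
  "(bounded_ops :: ('h::complex_hilbert_space \<Rightarrow>\<^sub>L 'h) set) \<subseteq> topspace sigma_weak_topology"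
proof -
  have "square_summable (\<lambda>_. 0::'h)" by (simp add: square_summable_def)
  then have "(bounded_ops :: ('h \<Rightarrow>\<^sub>L 'h) set)
      \<in> {{T \<in> bounded_ops. (\<Sum>n. cinner (blinfun_apply T (\<xi> n)) (\<eta> n)) \<in> V} | \<xi> \<eta> V.
        square_summable \<xi> \<and> square_summable \<eta> \<and> open V}"
    by (intro CollectI exI[of _ "\<lambda>_. 0"] exI[of _ UNIV]) auto
  then show ?thesis unfolding sigma_weak_topology_def topology_generated_by_topspace by blast
qed

lemma normal_on_tendsto:
  assumes F: "F \<noteq> bot" and M: "von_neumann_algebra M" and \<phi>: "normal_on M \<phi>"
    and x: "x \<in> bounded_seqs M" and z: "tends_weakly x z F"
  shows "((\<lambda>n. \<phi> (x n)) \<longlongrightarrow> \<phi> z) F"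
proof (rule topological_tendstoI)
  fix V assume V: "open V" "\<phi> z \<in> V"
  have xM: "x n \<in> M" and xb: "x n \<in> bounded_ops" for n
    using x von_neumann_algebra_bounded_ops[OF M] by (auto simp: bounded_seqs_def)
  have zM: "z \<in> M" by (rule von_neumann_algebra_weak_limit[OF M F z xM])
  have "openin (subtopology sigma_weak_topology M)
      {T \<in> topspace (subtopology sigma_weak_topology M). \<phi> T \<in> V}"
    using openin_continuous_map_preimage[OF \<phi>[unfolded normal_on_def]] V(1) by simp
  then obtain U where U: "openin sigma_weak_topology U"
    "{T \<in> topspace (subtopology sigma_weak_topology M). \<phi> T \<in> V} = U \<inter> M"
    unfolding openin_subtopology by blast
  have "z \<in> U"
    using U(2) zM V(2) bounded_ops_subset_topspace von_neumann_algebra_bounded_ops[OF M zM] by auto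
  then have "eventually (\<lambda>n. x n \<in> U) F"
    using tends_weakly_sigma_weak[OF F z _ xb U(1)] x by (simp add: bounded_seqs_def)
  then show "eventually (\<lambda>n. \<phi> (x n) \<in> V) F"
    by (rule eventually_mono) (use U(2) xM in blast)
qed

text \<open>The limit \<open>z\<close> is chosen before the functional, so that one \<open>z\<close> serves both states of the
  main result.\<close>

lemma bounded_seqs_weak_limit:
  assumes \<omega>: "free_ultrafilter \<omega>" and M: "von_neumann_algebra M" and x: "x \<in> bounded_seqs M"
  obtains z where "z \<in> M" "tends_weakly x z \<omega>"
    "\<And>\<phi>. normal_on M \<phi> \<Longrightarrow> ((\<lambda>n. \<phi> (x n)) \<longlongrightarrow> \<phi> z) \<omega>"
proof -
  obtain z where z: "tends_weakly x z \<omega>"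
    using weak_limit_exists[OF \<omega>] x by (auto simp: bounded_seqs_def)
  moreover have "z \<in> M"
    using von_neumann_algebra_weak_limit[OF M free_ultrafilterD(1)[OF \<omega>] z] x
    by (simp add: bounded_seqs_def)
  ultimately show thesis
    using that normal_on_tendsto[OF free_ultrafilterD(1)[OF \<omega>] M _ x z] by blast
qed

section \<open>Null sequences do not depend on the state\<close>

lemma state_square_nonneg:
  assumes "state_on M \<phi>" "x \<in> M"
  shows "Re (\<phi> (adj x o\<^sub>L x)) \<ge> 0" "\<phi> (adj x o\<^sub>L x) = of_real (Re (\<phi> (adj x o\<^sub>L x)))"
  using assms by (auto simp: state_on_def complex_nonneg_Reals_iff complex_eq_iff)

text \<open>The value of the state at the square of \<open>x + c y\<close> is nonnegative for every complex \<open>c\<close>. The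
  choices \<open>c = 1\<close> and \<open>c = \<i>\<close> show that the form is Hermitian; then \<open>c = - t \<beta>\<close> with \<open>t\<close> real gives
  the inequality.\<close>

lemma state_Cauchy_Schwarz:
  assumes M: "von_neumann_algebra M" and \<phi>: "state_on M \<phi>" and x: "x \<in> M" and y: "y \<in> M"
  shows "(cmod (\<phi> (adj y o\<^sub>L x)))\<^sup>2 \<le> Re (\<phi> (adj x o\<^sub>L x)) * Re (\<phi> (adj y o\<^sub>L y))"
proof -
  note closed = von_neumann_algebra_closed[OF M]
  define \<beta> \<gamma> p q where "\<beta> = \<phi> (adj y o\<^sub>L x)" "\<gamma> = \<phi> (adj x o\<^sub>L y)"
    "p = Re (\<phi> (adj x o\<^sub>L x))" "q = Re (\<phi> (adj y o\<^sub>L y))"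
  have p: "\<phi> (adj x o\<^sub>L x) = of_real p" and q: "\<phi> (adj y o\<^sub>L y) = of_real q" "q \<ge> 0" "p \<ge> 0"
    using state_square_nonneg[OF \<phi>] x y by (simp_all add: \<beta>_\<gamma>_p_q_def)
  have expand: "of_real p + cnj c * \<beta> + c * \<gamma> + c * cnj c * of_real q \<in> \<real>\<^sub>\<ge>\<^sub>0" for c
  proof -
    have "adj (x + scaleC_op c y) o\<^sub>L (x + scaleC_op c y)
        = ((adj x o\<^sub>L x) + scaleC_op (cnj c) (adj y o\<^sub>L x))
          + (scaleC_op c (adj x o\<^sub>L y) + scaleC_op (c * cnj c) (adj y o\<^sub>L y))"
      using closed x y
      by (intro blinfun_eqI)
        (simp add: adj_add adj_scaleC bounded_ops_scaleC blinfun.add_left blinfun.add_right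
          scaleC_op.rep_eq bounded_opsD scaleC_scaleC scaleC_add_right mult.commute)
    then have "\<phi> (adj (x + scaleC_op c y) o\<^sub>L (x + scaleC_op c y))
        = of_real p + cnj c * \<beta> + c * \<gamma> + c * cnj c * of_real q"
      using \<phi> closed x y by (simp add: state_on_def p q \<beta>_\<gamma>_p_q_def(1,2))
    then show ?thesis using \<phi> closed x y by (metis state_on_def)
  qed
  have "\<gamma> = cnj \<beta>"
    using expand[of 1] expand[of \<i>] by (auto simp: complex_nonneg_Reals_iff complex_eq_iff)
  have *: "(cmod \<beta>)\<^sup>2 * (2 * t - t\<^sup>2 * q) \<le> p" for t
  proof -
    define c where "c = - of_real t * \<beta>"
    have "of_real p + cnj c * \<beta> + c * \<gamma> + c * cnj c * of_real q
        = of_real p - of_real (2 * t) * (\<beta> * cnj \<beta>) + of_real (t\<^sup>2 * q) * (\<beta> * cnj \<beta>)"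
      by (simp add: \<open>\<gamma> = cnj \<beta>\<close> c_def algebra_simps power2_eq_square)
    also have "\<dots> = of_real (p - (cmod \<beta>)\<^sup>2 * (2 * t - t\<^sup>2 * q))"
      by (simp add: complex_norm_square[symmetric] algebra_simps)
    finally have "of_real (p - (cmod \<beta>)\<^sup>2 * (2 * t - t\<^sup>2 * q)) \<in> (\<real>\<^sub>\<ge>\<^sub>0 :: complex set)"
      using expand[of c] by metis
    then show ?thesis by (simp only: nonneg_Reals_of_real_iff)
  qed
  have "(cmod \<beta>)\<^sup>2 \<le> p * q"
  proof (cases "q = 0")
    case True
    \<comment> \<open>The bound now reads \<open>2 t |\<beta>|\<^sup>2 \<le> p\<close>, for arbitrarily large \<open>t\<close>.\<close>
    have "(cmod \<beta>)\<^sup>2 = 0"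
    proof (rule ccontr)
      assume "(cmod \<beta>)\<^sup>2 \<noteq> 0"
      then have "(cmod \<beta>)\<^sup>2 * (2 * ((p + 1) / (cmod \<beta>)\<^sup>2)) = 2 * (p + 1)" by simp
      then have "2 * (p + 1) \<le> p" using *[of "(p + 1) / (cmod \<beta>)\<^sup>2"] True by simp
      then show False using \<open>p \<ge> 0\<close> by simp
    qed
    then show ?thesis using True by simp
  next
    case False
    then have "(cmod \<beta>)\<^sup>2 / q \<le> p" using *[of "1 / q"] by (simp add: power2_eq_square)
    then show ?thesis using False \<open>q \<ge> 0\<close> by (simp add: field_simps)
  qed
  then show ?thesis by (simp add: \<beta>_\<gamma>_p_q_def)
qed

text \<open>
  The direction from \<open>\<phi>\<close> to strong convergence is where faithfulness enters. Let \<open>h\<close> be the weak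
  limit of \<open>x\<^sub>n\<^sup>* x\<^sub>n\<close>, so that \<open>\<phi> (h\<^sup>* h)\<close> is the limit of \<open>\<phi> (h\<^sup>* x\<^sub>n\<^sup>* x\<^sub>n)\<close>. Cauchy--Schwarz bounds
  the square of the modulus of the latter by \<open>\<phi> (x\<^sub>n\<^sup>* x\<^sub>n)\<close>, which tends to \<open>0\<close>, times
  \<open>\<phi> ((x\<^sub>n h)\<^sup>* (x\<^sub>n h))\<close>, which converges by normality. Hence \<open>h = 0\<close>.
\<close>

lemma state_square_null_iff:
  assumes \<omega>: "free_ultrafilter \<omega>" and M: "von_neumann_algebra M"
    and \<phi>: "normal_faithful_state M \<phi>" and x: "x \<in> bounded_seqs M"
  shows "((\<lambda>n. \<phi> (adj (x n) o\<^sub>L x n)) \<longlongrightarrow> 0) \<omega> \<longleftrightarrow> tends_strongly_0 x \<omega>"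
proof
  note closed = von_neumann_algebra_closed[OF M]
  note nt = free_ultrafilterD(1)[OF \<omega>]
  have st: "state_on M \<phi>" and no: "normal_on M \<phi>" and fa: "faithful_on M \<phi>"
    using \<phi> by (auto simp: normal_faithful_state_def)
  have xM: "x n \<in> M" for n using x by (simp add: bounded_seqs_def)
  have sq: "(\<lambda>n. adj (x n) o\<^sub>L x n) \<in> bounded_seqs M"
    by (intro bounded_seqs_compose[OF M] bounded_seqs_adj[OF M] x)
  show "tends_strongly_0 x \<omega>" if null: "((\<lambda>n. \<phi> (adj (x n) o\<^sub>L x n)) \<longlongrightarrow> 0) \<omega>"
  proof -
    obtain h where h: "h \<in> M" "tends_weakly (\<lambda>n. adj (x n) o\<^sub>L x n) h \<omega>"
      using bounded_seqs_weak_limit[OF \<omega> M sq] by metis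
    define k where "k n = x n o\<^sub>L h" for n
    have k: "k \<in> bounded_seqs M"
      unfolding k_def[abs_def] by (intro bounded_seqs_compose[OF M] bounded_seqs_const x h)
    then have kM: "k n \<in> M" for n by (simp add: bounded_seqs_def)
    obtain w where w: "((\<lambda>n. \<phi> (adj (k n) o\<^sub>L k n)) \<longlongrightarrow> \<phi> w) \<omega>"
      using bounded_seqs_weak_limit[OF \<omega> M bounded_seqs_compose[OF M bounded_seqs_adj[OF M k] k]] no
      by metis
    have "adj (k n) o\<^sub>L x n = adj h o\<^sub>L (adj (x n) o\<^sub>L x n)" for n
      using xM h(1) closed by (simp add: k_def adj_compose blinfun_compose_assoc)
    then have le: "(cmod (\<phi> (adj h o\<^sub>L (adj (x n) o\<^sub>L x n))))\<^sup>2
        \<le> Re (\<phi> (adj (x n) o\<^sub>L x n)) * Re (\<phi> (adj (k n) o\<^sub>L k n))" for n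
      using state_Cauchy_Schwarz[OF M st xM kM, of n n] by simp
    have "((\<lambda>n. \<phi> (adj h o\<^sub>L (adj (x n) o\<^sub>L x n))) \<longlongrightarrow> \<phi> (adj h o\<^sub>L h)) \<omega>"
      using h closed
      by (intro normal_on_tendsto[OF nt M no] tends_weakly_compose_left
          bounded_seqs_compose[OF M bounded_seqs_const sq]) auto
    then have "((\<lambda>n. (cmod (\<phi> (adj h o\<^sub>L (adj (x n) o\<^sub>L x n))))\<^sup>2)
        \<longlongrightarrow> (cmod (\<phi> (adj h o\<^sub>L h)))\<^sup>2) \<omega>"
      by (intro tendsto_intros)
    moreover have "((\<lambda>n. Re (\<phi> (adj (x n) o\<^sub>L x n)) * Re (\<phi> (adj (k n) o\<^sub>L k n)))
        \<longlongrightarrow> Re 0 * Re (\<phi> w)) \<omega>"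
      by (intro tendsto_intros null w)
    ultimately have "(cmod (\<phi> (adj h o\<^sub>L h)))\<^sup>2 \<le> Re 0 * Re (\<phi> w)"
      using le by (intro tendsto_le[OF nt]) auto
    then have "h = 0" using fa h(1) by (auto simp: faithful_on_def)
    then show ?thesis
      using h(2) tends_weakly_square_iff[of x] xM closed by simp
  qed
  show "((\<lambda>n. \<phi> (adj (x n) o\<^sub>L x n)) \<longlongrightarrow> 0) \<omega>" if "tends_strongly_0 x \<omega>"
  proof -
    have weak: "tends_weakly (\<lambda>n. adj (x n) o\<^sub>L x n) 0 \<omega>"
      using that tends_weakly_square_iff[of x] xM closed by simp
    have "\<phi> (0 + 0) = \<phi> 0 + \<phi> 0"
      using st von_neumann_algebra_zero[OF M] unfolding state_on_def by blast
    then show ?thesis using normal_on_tendsto[OF nt M no sq weak] by simp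
  qed
qed

text \<open>The square of the seminorm is \<open>\<phi> (x\<^sup>* x) + \<phi> (x x\<^sup>*)\<close> with both terms nonnegative, so the previous
  lemma applies to \<open>x\<close> and to its adjoint separately. The resulting description does not mention
  \<open>\<phi>\<close>; this is the independence of the ultrapower from the state.\<close>

lemma null_seqs_eq:
  assumes \<omega>: "free_ultrafilter \<omega>" and M: "von_neumann_algebra M"
    and \<phi>: "normal_faithful_state M \<phi>"
  shows "null_seqs \<omega> M \<phi> = {x \<in> bounded_seqs M.
    tends_strongly_0 x \<omega> \<and> tends_strongly_0 (\<lambda>n. adj (x n)) \<omega>}"
proof -
  note closed = von_neumann_algebra_closed[OF M]
  have st: "state_on M \<phi>" using \<phi> by (auto simp: normal_faithful_state_def)
  have "((\<lambda>n. sharp_norm \<phi> (x n)) \<longlongrightarrow> 0) \<omega>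
      \<longleftrightarrow> tends_strongly_0 x \<omega> \<and> tends_strongly_0 (\<lambda>n. adj (x n)) \<omega>"
    if x: "x \<in> bounded_seqs M" for x
  proof -
    have xM: "x n \<in> M" for n using x by (simp add: bounded_seqs_def)
    define a where "a n = Re (\<phi> (adj (x n) o\<^sub>L x n))" for n
    define b where "b n = Re (\<phi> (adj (adj (x n)) o\<^sub>L adj (x n)))" for n
    have a: "a n \<ge> 0" "\<phi> (adj (x n) o\<^sub>L x n) = of_real (a n)" for n
      unfolding a_def using state_square_nonneg[OF st xM] by blast+
    have b: "b n \<ge> 0" "\<phi> (adj (adj (x n)) o\<^sub>L adj (x n)) = of_real (b n)" for n
      unfolding b_def using state_square_nonneg[OF st von_neumann_algebra_adj[OF M xM]] by blast+
    have norm: "sharp_norm \<phi> (x n) = sqrt (a n + b n)" for n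
      using st xM closed by (simp add: sharp_norm_def a_def b_def state_on_def adj_adj)
    have "((\<lambda>n. sharp_norm \<phi> (x n)) \<longlongrightarrow> 0) \<omega> \<longleftrightarrow> ((\<lambda>n. a n + b n) \<longlongrightarrow> 0) \<omega>"
    proof
      assume "((\<lambda>n. sharp_norm \<phi> (x n)) \<longlongrightarrow> 0) \<omega>"
      then have "((\<lambda>n. (sharp_norm \<phi> (x n))\<^sup>2) \<longlongrightarrow> 0\<^sup>2) \<omega>" by (rule tendsto_power)
      then show "((\<lambda>n. a n + b n) \<longlongrightarrow> 0) \<omega>" using a b by (simp add: norm)
    next
      assume "((\<lambda>n. a n + b n) \<longlongrightarrow> 0) \<omega>"
      then show "((\<lambda>n. sharp_norm \<phi> (x n)) \<longlongrightarrow> 0) \<omega>"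
        using tendsto_real_sqrt by (fastforce simp: norm)
    qed
    also have "\<dots> \<longleftrightarrow> (a \<longlongrightarrow> 0) \<omega> \<and> (b \<longlongrightarrow> 0) \<omega>"
    proof (intro iffI conjI)
      assume ab: "((\<lambda>n. a n + b n) \<longlongrightarrow> 0) \<omega>"
      show "(a \<longlongrightarrow> 0) \<omega>" "(b \<longlongrightarrow> 0) \<omega>"
        using a b by (auto intro!: Lim_null_comparison[OF _ ab])
    next
      assume "(a \<longlongrightarrow> 0) \<omega> \<and> (b \<longlongrightarrow> 0) \<omega>"
      then show "((\<lambda>n. a n + b n) \<longlongrightarrow> 0) \<omega>" by (auto intro: tendsto_add_zero)
    qed
    also have "\<dots> \<longleftrightarrow> tends_strongly_0 x \<omega> \<and> tends_strongly_0 (\<lambda>n. adj (x n)) \<omega>"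
      using state_square_null_iff[OF \<omega> M \<phi> x] state_square_null_iff[OF \<omega> M \<phi> bounded_seqs_adj[OF M x]]
      by (simp add: a b tendsto_of_real_iff[where 'a=complex, of _ 0, simplified])
    finally show ?thesis .
  qed
  then show ?thesis by (auto simp: null_seqs_def)
qed

section \<open>The relative commutant\<close>

text \<open>The product of two cosets is a union over representatives, so commutation of the classes
  only gives \<open>a x = i + u c\<close> for some other representatives \<open>u\<close> of \<open>X\<close> and \<open>c\<close> of \<open>a\<close>. Modulo strongly
  null sequences \<open>u c\<close> can be replaced by \<open>x a\<close>: the error terms are \<open>u (c - a)\<close>, with \<open>u\<close>
  bounded, and \<open>(u - x) a\<close>.\<close>

lemma relative_commutant_representative:
  fixes M :: "('h::complex_hilbert_space \<Rightarrow>\<^sub>L 'h) set"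
  assumes \<omega>: "free_ultrafilter \<omega>" and M: "von_neumann_algebra M"
    and \<phi>: "normal_faithful_state M \<phi>"
    and X: "X \<in> relative_commutant \<omega> M \<phi>" and x: "x \<in> X"
  shows "x \<in> bounded_seqs M" and "a \<in> M \<Longrightarrow> tends_strongly_0 (\<lambda>n. (a o\<^sub>L x n) - (x n o\<^sub>L a)) \<omega>"
proof -
  define I where "I = null_seqs \<omega> M \<phi>"
  have I: "i \<in> bounded_seqs M" "tends_strongly_0 i \<omega>" if "i \<in> I" for i
    using that null_seqs_eq[OF \<omega> M \<phi>] by (auto simp: I_def)
  have carrier: "carrier (multiplier_ring \<omega> M \<phi>) = multiplier_seqs \<omega> M \<phi>"
    by (simp add: multiplier_ring_def)
  have coset: "I +>\<^bsub>multiplier_ring \<omega> M \<phi>\<^esub> u = {(\<lambda>n. i n + u n) | i. i \<in> I}" for u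
    by (auto simp: a_r_coset_def' multiplier_ring_def)
  obtain x\<^sub>0 where x0: "x\<^sub>0 \<in> multiplier_seqs \<omega> M \<phi>" and X_eq: "X = {(\<lambda>n. i n + x\<^sub>0 n) | i. i \<in> I}"
    using X unfolding relative_commutant_def ocneanu_ultrapower_def FactRing_def A_RCOSETS_def'
    by (auto simp: coset carrier simp flip: I_def)
  have X_bounded: "u \<in> bounded_seqs M" if "u \<in> X" for u
    using that x0 bounded_seqs_add[OF M] I by (auto simp: X_eq multiplier_seqs_def)
  then show xb: "x \<in> bounded_seqs M" using x .
  assume a: "a \<in> M"
  have zero: "(\<lambda>_. 0) \<in> I"
  proof -
    have "0 \<in> M"
      by (rule von_neumann_algebra_zero[OF M])
    moreover have "adj 0 = (0 :: 'h \<Rightarrow>\<^sub>L 'h)"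
      by (rule adj_eqI[OF von_neumann_algebra_bounded_ops[OF M \<open>0 \<in> M\<close>]]) (simp add: cinner_zero)
    ultimately show ?thesis
      unfolding I_def null_seqs_eq[OF \<omega> M \<phi>] by (simp add: bounded_seqs_const tends_strongly_0_def)
  qed
  define C where "C = {(\<lambda>n. i n + a) | i. i \<in> I}"
  have "rcoset_mult (multiplier_ring \<omega> M \<phi>) I C X = rcoset_mult (multiplier_ring \<omega> M \<phi>) I X C"
    using X a unfolding relative_commutant_def ocneanu_ultrapower_def FactRing_def const_class_def
    by (auto simp: coset C_def simp flip: I_def)
  moreover have "(\<lambda>n. a o\<^sub>L x n) \<in> rcoset_mult (multiplier_ring \<omega> M \<phi>) I C X"
  proof -
    have "(\<lambda>_. a) \<in> C" unfolding C_def using zero by force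
    moreover have "(\<lambda>n. a o\<^sub>L x n) \<in> I +>\<^bsub>multiplier_ring \<omega> M \<phi>\<^esub> (\<lambda>n. a o\<^sub>L x n)"
      unfolding coset using zero by force
    ultimately show ?thesis
      unfolding rcoset_mult_def using x by (fastforce simp: multiplier_ring_def)
  qed
  ultimately obtain u c where u: "u \<in> X" and c: "c \<in> C"
    and "(\<lambda>n. a o\<^sub>L x n) \<in> I +>\<^bsub>multiplier_ring \<omega> M \<phi>\<^esub> (\<lambda>n. u n o\<^sub>L c n)"
    unfolding rcoset_mult_def by (auto simp: multiplier_ring_def)
  then obtain i where i: "i \<in> I" "(\<lambda>n. a o\<^sub>L x n) = (\<lambda>n. i n + (u n o\<^sub>L c n))"
    unfolding coset by blast
  obtain j where j: "j \<in> I" "c = (\<lambda>n. j n + a)" using c unfolding C_def by blast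
  obtain k l where kl: "k \<in> I" "l \<in> I" "u = (\<lambda>n. k n + x\<^sub>0 n)" "x = (\<lambda>n. l n + x\<^sub>0 n)"
    using u x unfolding X_eq by blast
  have "(a o\<^sub>L x n) - (x n o\<^sub>L a) = i n + (u n o\<^sub>L j n) + ((k n - l n) o\<^sub>L a)" for n
    using fun_cong[OF i(2), of n]
    by (simp add: j(2) kl(3,4) blinfun_compose_distribs algebra_simps)
  then show "tends_strongly_0 (\<lambda>n. (a o\<^sub>L x n) - (x n o\<^sub>L a)) \<omega>"
    using I[OF i(1)] I[OF j(1)] I[OF kl(1)] I[OF kl(2)] X_bounded[OF u]
    by (simp add: tends_strongly_0_add tends_strongly_0_diff tends_strongly_0_compose_left
        tends_strongly_0_compose_right bounded_seqs_def)
qed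

lemma relative_commutant_limit_central:
  assumes \<omega>: "free_ultrafilter \<omega>" and M: "von_neumann_algebra M"
    and \<phi>: "normal_faithful_state M \<phi>"
    and X: "X \<in> relative_commutant \<omega> M \<phi>" and x: "x \<in> X"
  obtains z where "z \<in> center M" "\<And>\<psi>. normal_on M \<psi> \<Longrightarrow> ((\<lambda>n. \<psi> (x n)) \<longlongrightarrow> \<psi> z) \<omega>"
proof -
  note rep = relative_commutant_representative[OF \<omega> M \<phi> X x]
  obtain z where z: "z \<in> M" "tends_weakly x z \<omega>"
    "\<And>\<psi>. normal_on M \<psi> \<Longrightarrow> ((\<lambda>n. \<psi> (x n)) \<longlongrightarrow> \<psi> z) \<omega>"
    using bounded_seqs_weak_limit[OF \<omega> M rep(1)] by metis
  have "z o\<^sub>L a = a o\<^sub>L z" if a: "a \<in> M" for a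
  proof -
    have "tends_weakly (\<lambda>n. (a o\<^sub>L x n) - (x n o\<^sub>L a)) ((a o\<^sub>L z) - (z o\<^sub>L a)) \<omega>"
      using z(2) a von_neumann_algebra_bounded_ops[OF M]
      by (intro tends_weakly_diff tends_weakly_compose_left tends_weakly_compose_right) auto
    moreover have "tends_weakly (\<lambda>n. (a o\<^sub>L x n) - (x n o\<^sub>L a)) 0 \<omega>"
      by (rule tends_strongly_0_imp_weakly[OF rep(2)[OF a]])
    ultimately have "(a o\<^sub>L z) - (z o\<^sub>L a) = 0"
      by (rule tends_weakly_unique[OF free_ultrafilterD(1)[OF \<omega>]])
    then show ?thesis by simp
  qed
  then show thesis using that z by (auto simp: center_def)
qed

lemma relative_commutant_cong:
  assumes "null_seqs \<omega> M \<phi> = null_seqs \<omega> M \<psi>"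
  shows "relative_commutant \<omega> M \<phi> = relative_commutant \<omega> M \<psi>"
proof -
  have "multiplier_ring \<omega> M \<phi> = multiplier_ring \<omega> M \<psi>"
    by (simp add: multiplier_ring_def multiplier_seqs_def assms)
  then show ?thesis
    by (simp add: relative_commutant_def ocneanu_ultrapower_def const_class_def assms)
qed

lemma dot_state_eq:
  assumes \<omega>: "free_ultrafilter \<omega>" and M: "von_neumann_algebra M"
    and \<phi>: "normal_faithful_state M \<phi>" and \<psi>: "normal_faithful_state M \<psi>"
    and center: "\<forall>z\<in>center M. \<phi> z = \<psi> z"
  shows "dot_state \<omega> M \<phi> = dot_state \<omega> M \<psi>"
proof -
  have "ultrapower_state \<omega> \<phi> X = ultrapower_state \<omega> \<psi> X" if X: "X \<in> relative_commutant \<omega> M \<phi>" for X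
  proof -
    have "((\<lambda>n. \<phi> (x n)) \<longlongrightarrow> c) \<omega> \<longleftrightarrow> ((\<lambda>n. \<psi> (x n)) \<longlongrightarrow> c) \<omega>" if xX: "x \<in> X" for x c
    proof -
      obtain z where "z \<in> center M"
        "\<And>\<rho>. normal_on M \<rho> \<Longrightarrow> ((\<lambda>n. \<rho> (x n)) \<longlongrightarrow> \<rho> z) \<omega>"
        using relative_commutant_limit_central[OF \<omega> M \<phi> X xX] by metis
      then have "((\<lambda>n. \<phi> (x n)) \<longlongrightarrow> \<phi> z) \<omega>" "((\<lambda>n. \<psi> (x n)) \<longlongrightarrow> \<phi> z) \<omega>"
        using \<phi> \<psi> center unfolding normal_faithful_state_def by metis+
      then show ?thesis
        using tendsto_unique[OF free_ultrafilterD(1)[OF \<omega>]] by metis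
    qed
    then show ?thesis unfolding ultrapower_state_def by (simp cong: ball_cong)
  qed
  moreover have "relative_commutant \<omega> M \<phi> = relative_commutant \<omega> M \<psi>"
    by (rule relative_commutant_cong) (simp add: null_seqs_eq[OF \<omega> M \<phi>] null_seqs_eq[OF \<omega> M \<psi>])
  ultimately show ?thesis unfolding dot_state_def by (auto intro: restrict_ext)
qed

lemma factor_states_agree_on_center:
  assumes "factor M" "state_on M \<phi>" "state_on M \<psi>" "z \<in> center M"
  shows "\<phi> z = \<psi> z"
proof -
  have "id_blinfun \<in> M"
    using assms(1) von_neumann_algebra_id by (auto simp: factor_def)
  moreover obtain c where "z = scaleC_op c id_blinfun"
    using assms(1,4) by (auto simp: factor_def)
  ultimately show ?thesis using assms(2,3) by (simp add: state_on_def)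
qed

theorem proposition4p29:
  fixes \<omega> :: "nat filter"
    and M :: "('h::complex_hilbert_space \<Rightarrow>\<^sub>L 'h) set"
  assumes "free_ultrafilter \<omega>"
    and "von_neumann_algebra M"
    and "sigma_finite_algebra M"
  shows "(\<forall>\<phi> \<psi>. normal_faithful_state M \<phi> \<and> normal_faithful_state M \<psi> \<and>
            (\<forall>z\<in>center M. \<phi> z = \<psi> z) \<longrightarrow> dot_state \<omega> M \<phi> = dot_state \<omega> M \<psi>) \<and>
         (factor M \<longrightarrow>
            (\<forall>\<phi> \<psi>. normal_faithful_state M \<phi> \<and> normal_faithful_state M \<psi> \<longrightarrow>
               dot_state \<omega> M \<phi> = dot_state \<omega> M \<psi>))"
proof (intro conjI allI impI)
  fix \<phi> \<psi> :: "('h \<Rightarrow>\<^sub>L 'h) \<Rightarrow> complex"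
  show "dot_state \<omega> M \<phi> = dot_state \<omega> M \<psi>"
    if "normal_faithful_state M \<phi> \<and> normal_faithful_state M \<psi> \<and> (\<forall>z\<in>center M. \<phi> z = \<psi> z)"
    using that dot_state_eq[OF assms(1,2)] by blast
  show "dot_state \<omega> M \<phi> = dot_state \<omega> M \<psi>"
    if "factor M" "normal_faithful_state M \<phi> \<and> normal_faithful_state M \<psi>"
    using that factor_states_agree_on_center[OF that(1), of \<phi> \<psi>]
    by (intro dot_state_eq[OF assms(1,2)]) (auto simp: normal_faithful_state_def)
qed

end
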